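(* Let $\phi$ be a conjunction of xor-clauses in 3-xor normal form. If $\phi$ is cycle-partitionable, then $\phi$ is Subst-deducible (and thus also EC-deducible).
   Context: **Xor-clauses.** An xor-clause is an equation $z_1\oplus\dots\oplus z_k\equiv p$ over distinct propositional variables with $p\in\{\bot,\top\}$ ($\oplus$ is exclusive or); equivalently an expression $z_1\oplus\dots\oplus z_k$ (parity $\top$) or $z_1\oplus\dots\oplus z_k\oplus\top$ (parity $\bot$), always kept in normal form by cancelling repeated atoms. The literal $x$ is identified with $(x\equiv\top)$ and $\neg x$ with $(x\equiv\bot)$. The unsatisfiable empty xor-clause is identified with $\bot$. $\mathrm{vars}(\phi)$ is the set of variables of $\phi$, $\mathrm{lits}(\phi)=\{x,\neg x\mid x\in\mathrm{vars}(\phi)\}$, and $\models$ is logical consequence. **3-xor normal form.** $\phi$ is in 3-xor normal form if (i) every xor-clause in it has exactly three variables, and (ii) each pair of distinct xor-clauses in it shares at most one variable. **Xor-cycles and cycle-partitionability.** An xor-cycle in $\phi$ is a conjunction of pairwise distinct xor-clauses of $\phi$ of the form $(x_1\oplus x_2\oplus y_1\equiv p_1)\wedge\dots\wedge(x_{n-1}\oplus x_n\oplus y_{n-1}\equiv p_{n-1})\wedge(x_1\oplus x_n\oplus y_n\equiv p_n)$ with $n\ge 3$ and $x_1,\dots,x_n$ pairwise distinct; $X=\{x_1,\dots,x_n\}$ are its inner variables and $Y=\{y_1,\dots,y_n\}$ its outer variables. $\phi$ is cycle-partitionable if there is a partition of $\mathrm{vars}(\phi)$ into two disjoint sets $V_{\mathrm{in}},V_{\mathrm{out}}$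 such that for each xor-cycle in $\phi$, with inner variables $X$ and outer variables $Y$, $X\subseteq V_{\mathrm{in}}$ and $Y\subseteq V_{\mathrm{out}}$. **Subst.** $C[A/D]$ is the normal form of the xor-clause obtained from $C$ by replacing the atom $A$ by $D$ (all occurrences, once). The rules of Subst are, for variables $x,y$ and an xor-clause $C$: from $(x\equiv\top)$ and $C$ infer $C[x/\top]$; from $(x\equiv\bot)$ and $C$ infer $C[x/\bot]$; from $(x\oplus y\equiv\bot)$ and $C$ infer $C[x/y]$; from $(x\oplus y\equiv\top)$ and $C$ infer $C[x/(y\oplus\top)]$. **EC.** The rules of EC are (variables in one displayed xor-clause are distinct, $x_1,\dots,x_n$ pairwise distinct, $a,b,c_i,d\in\{\bot,\top\}$): from $(x\equiv\top),(x\equiv\bot)$ infer $\bot$; from $(x\equiv a),(x\oplus y\equiv b)$ infer $(y\equiv a\oplus b)$; from $(x\equiv a),(x\oplus y\oplus z\equiv b)$ infer $(y\oplus z\equiv a\oplus b)$; from $(x_1\oplus x_2\equiv c_1),\dots,(x_{n-1}\oplus x_n\equiv c_{n-1}),(x_1\oplus x_n\oplus y\equiv d)$ infer $(y\equiv c_1\oplus\dots\oplus c_{n-1}\oplus d)$; from $(x_1\oplus x_2\equiv c_1),\dots,(x_{n-1}\oplus x_n\equiv c_{n-1}),(x_n\oplus x_1\equiv c_n)$ with $c_1\oplus\dots\oplus c_n=\top$ infer $\bot$. **Derivability and deducibility.** For $S\in\{\mathrm{Subst},\mathrm{EC}\}$, an $S$-derivation from $\psi$ is a finite sequence of xor-clauses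 each in $\psi$ or inferred from earlier ones by a rule of $S$; $\psi\vdash_S D$ means $D$ occurs in some $S$-derivation from $\psi$. $\phi$ is $S$-deducible if for all $k\ge0$ and $\tilde l_1,\dots,\tilde l_k,\hat l\in\mathrm{lits}(\phi)$: (i) if $\phi\wedge\tilde l_1\wedge\dots\wedge\tilde l_k$ is unsatisfiable, then $\phi\wedge\tilde l_1\wedge\dots\wedge\tilde l_k\vdash_S\bot$; and (ii) otherwise, $\phi\wedge\tilde l_1\wedge\dots\wedge\tilde l_k\models\hat l$ implies $\phi\wedge\tilde l_1\wedge\dots\wedge\tilde l_k\vdash_S\hat l$. *)

theory Defs
  imports Main
begin

text \<open>
  The pair \<open>(V, p)\<close> stands for the xor-clause that equates the exclusive or of the variables
  in \<open>V\<close> with the truth value \<open>p\<close>.  Since \<open>V\<close> is a set, xor-clauses are always in normal form.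
  The sets \<open>V\<close> are meant to be finite; every xor-clause of a formula in 3-xor normal form, every
  literal, and hence everything derived from them has a finite set of variables.
  A conjunction of xor-clauses is the set of its conjuncts.
\<close>
type_synonym 'v xor_clause = "'v set \<times> bool"

text \<open>The unsatisfiable empty xor-clause.\<close>
abbreviation falsum :: "'v xor_clause" where
  "falsum \<equiv> ({}, True)"

definition vars :: "'v xor_clause set \<Rightarrow> 'v set" where
  "vars \<phi> = (\<Union>C\<in>\<phi>. fst C)"

definition lits :: "'v xor_clause set \<Rightarrow> 'v xor_clause set" where
  "lits \<phi> = {({x}, b) | x b. x \<in> vars \<phi>}"

definition sat_clause :: "('v \<Rightarrow> bool) \<Rightarrow> 'v xor_clause \<Rightarrow> bool" where
  "sat_clause \<tau> C \<longleftrightarrow> odd (card {x \<in> fst C. \<tau> x}) = snd C"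

definition satisfies :: "('v \<Rightarrow> bool) \<Rightarrow> 'v xor_clause set \<Rightarrow> bool" where
  "satisfies \<tau> \<phi> \<longleftrightarrow> (\<forall>C\<in>\<phi>. sat_clause \<tau> C)"

definition satisfiable :: "'v xor_clause set \<Rightarrow> bool" where
  "satisfiable \<phi> \<longleftrightarrow> (\<exists>\<tau>. satisfies \<tau> \<phi>)"

definition entails :: "'v xor_clause set \<Rightarrow> 'v xor_clause \<Rightarrow> bool" where
  "entails \<phi> D \<longleftrightarrow> (\<forall>\<tau>. satisfies \<tau> \<phi> \<longrightarrow> sat_clause \<tau> D)"

definition three_xor_nf :: "'v xor_clause set \<Rightarrow> bool" where
  "three_xor_nf \<phi> \<longleftrightarrow>
     (\<forall>C\<in>\<phi>. card (fst C) = 3) \<and>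
     (\<forall>C\<in>\<phi>. \<forall>D\<in>\<phi>. C \<noteq> D \<longrightarrow> card (fst C \<inter> fst D) \<le> 1)"

text \<open>
  With \<open>n = length xs\<close>, the \<open>i\<close>-th xor-clause of an xor-cycle (\<open>i < n\<close>) consists of the two
  cyclically consecutive inner variables at positions \<open>i\<close> and \<open>i + 1\<close> (modulo \<open>n\<close>) and the
  \<open>i\<close>-th outer variable.
\<close>
definition cycle_clause :: "'v list \<Rightarrow> 'v list \<Rightarrow> bool list \<Rightarrow> nat \<Rightarrow> 'v xor_clause" where
  "cycle_clause xs ys ps i = ({xs ! i, xs ! (Suc i mod length xs), ys ! i}, ps ! i)"

definition xor_cycle :: "'v xor_clause set \<Rightarrow> 'v list \<Rightarrow> 'v list \<Rightarrow> bool list \<Rightarrow> bool" where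
  "xor_cycle \<phi> xs ys ps \<longleftrightarrow>
     length xs \<ge> 3 \<and> length ys = length xs \<and> length ps = length xs \<and>
     distinct xs \<and>
     (\<forall>i<length xs. ys ! i \<noteq> xs ! i \<and> ys ! i \<noteq> xs ! (Suc i mod length xs)) \<and>
     (\<forall>i<length xs. cycle_clause xs ys ps i \<in> \<phi>) \<and>
     inj_on (cycle_clause xs ys ps) {..<length xs}"

definition cycle_partitionable :: "'v xor_clause set \<Rightarrow> bool" where
  "cycle_partitionable \<phi> \<longleftrightarrow>
     (\<exists>V_in V_out. V_in \<union> V_out = vars \<phi> \<and> V_in \<inter> V_out = {} \<and>
        (\<forall>xs ys ps. xor_cycle \<phi> xs ys ps \<longrightarrow> set xs \<subseteq> V_in \<and> set ys \<subseteq> V_out))"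

text \<open>
  \<open>subst_atom C x (W, c)\<close> is the normal form of \<open>C\<close> after replacing the atom \<open>x\<close> by the exclusive
  or of the variables in \<open>W\<close> and the constant \<open>c\<close>.  So the second argument \<open>(W, c)\<close> is here an
  expression rather than an equation: the constant moves to the right-hand side of the clause.
\<close>
fun subst_atom :: "'v xor_clause \<Rightarrow> 'v \<Rightarrow> 'v set \<times> bool \<Rightarrow> 'v xor_clause" where
  "subst_atom (V, p) x (W, c) =
     (if x \<in> V then (sym_diff (V - {x}) W, p \<noteq> c) else (V, p))"

text \<open>
  A proof system is a relation between the set of premises and the conclusion of an inference.
  On truth values, \<open>\<noteq>\<close> is exclusive or.
\<close>
type_synonym 'v proof_system = "'v xor_clause set \<Rightarrow> 'v xor_clause \<Rightarrow> bool"

inductive Subst :: "'v proof_system" where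
  unit_pos: "Subst {({x}, True), C} (subst_atom C x ({}, True))"
| unit_neg: "Subst {({x}, False), C} (subst_atom C x ({}, False))"
| eqv_pos: "x \<noteq> y \<Longrightarrow> Subst {({x, y}, False), C} (subst_atom C x ({y}, False))"
| eqv_neg: "x \<noteq> y \<Longrightarrow> Subst {({x, y}, True), C} (subst_atom C x ({y}, True))"

definition xor_list :: "bool list \<Rightarrow> bool" where
  "xor_list cs = foldr (\<noteq>) cs False"

inductive EC :: "'v proof_system" where
  conflict: "EC {({x}, True), ({x}, False)} falsum"
| unit2: "x \<noteq> y \<Longrightarrow> EC {({x}, a), ({x, y}, b)} ({y}, a \<noteq> b)"
| unit3: "distinct [x, y, z] \<Longrightarrow> EC {({x}, a), ({x, y, z}, b)} ({y, z}, a \<noteq> b)"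
| imply: "length xs \<ge> 2 \<Longrightarrow> distinct xs \<Longrightarrow> y \<noteq> hd xs \<Longrightarrow> y \<noteq> last xs \<Longrightarrow>
    length cs = length xs - 1 \<Longrightarrow>
    EC ({({xs ! i, xs ! Suc i}, cs ! i) | i. Suc i < length xs} \<union> {({hd xs, last xs, y}, d)})
       ({y}, xor_list cs \<noteq> d)"
| eqv_conflict: "length xs \<ge> 2 \<Longrightarrow> distinct xs \<Longrightarrow> length cs = length xs \<Longrightarrow> xor_list cs \<Longrightarrow>
    EC {({xs ! i, xs ! (Suc i mod length xs)}, cs ! i) | i. i < length xs} falsum"

definition derivation ::
  "'v proof_system \<Rightarrow> 'v xor_clause set \<Rightarrow> 'v xor_clause list \<Rightarrow> bool" where
  "derivation S \<psi> Ds \<longleftrightarrow>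
     (\<forall>i<length Ds. Ds ! i \<in> \<psi> \<or> (\<exists>P \<subseteq> set (take i Ds). S P (Ds ! i)))"

definition derivable :: "'v proof_system \<Rightarrow> 'v xor_clause set \<Rightarrow> 'v xor_clause \<Rightarrow> bool" where
  "derivable S \<psi> D \<longleftrightarrow> (\<exists>Ds. derivation S \<psi> Ds \<and> D \<in> set Ds)"

definition deducible :: "'v proof_system \<Rightarrow> 'v xor_clause set \<Rightarrow> bool" where
  "deducible S \<phi> \<longleftrightarrow>
     (\<forall>ls l. set ls \<subseteq> lits \<phi> \<and> l \<in> lits \<phi> \<longrightarrow>
        (\<not> satisfiable (\<phi> \<union> set ls) \<longrightarrow> derivable S (\<phi> \<union> set ls) falsum) \<and>
        (satisfiable (\<phi> \<union> set ls) \<longrightarrow> entails (\<phi> \<union> set ls) l \<longrightarrow>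
           derivable S (\<phi> \<union> set ls) l))"

end

theory Submission
  imports Defs
begin

text \<open>
  In a clause \<open>e\<close> of a cycle-partitionable formula, some variable \<open>c\<close> is not connected to the other
  two once \<open>e\<close> is removed: otherwise every variable of \<open>e\<close> would be an inner variable of a cycle,
  while each of these cycles has an outer variable in \<open>e\<close>.

  Take a saturated set of derived clauses without the empty clause.  Up to satisfied clauses, the
  formula then consists of binary clauses, which form a consistent graph of equivalences, and of
  clauses whose three variables are unassigned and pairwise inequivalent.  Contracting the
  equivalence classes preserves the bridges, and a ternary hypergraph with a bridge at each edge is
  solvable for any right-hand sides and any prescribed value at one vertex: cut it at a bridge and
  glue the two solutions, or, if nothing hangs on any bridge, satisfy an edge with its private
  vertex.  So there is a model in which any given underived literal is false.
\<close>

section \<open>Parity of the true variables\<close>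

lemma odd_true_insert:
  assumes "finite V" "x \<notin> V"
  shows "odd (card {y \<in> insert x V. \<tau> y}) = (\<tau> x \<noteq> odd (card {y \<in> V. \<tau> y}))"
proof -
  have "{y \<in> insert x V. \<tau> y} =
      (if \<tau> x then insert x {y \<in> V. \<tau> y} else {y \<in> V. \<tau> y})" by auto
  then show ?thesis using assms by auto
qed

lemma odd_true_sym_diff:
  assumes "finite A" "finite B"
  shows "odd (card {y \<in> sym_diff A B. \<tau> y}) =
    (odd (card {y \<in> A. \<tau> y}) \<noteq> odd (card {y \<in> B. \<tau> y}))"
proof -
  let ?T = "\<lambda>X. {y \<in> X. \<tau> y}"
  have "card (?T A) = card (?T (A - B)) + card (?T (A \<inter> B))"
    using assms by (subst card_Un_disjoint [symmetric]) (auto intro: arg_cong [of _ _ card])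
  moreover have "card (?T B) = card (?T (B - A)) + card (?T (A \<inter> B))"
    using assms by (subst card_Un_disjoint [symmetric]) (auto intro: arg_cong [of _ _ card])
  moreover have "card (?T (sym_diff A B)) = card (?T (A - B)) + card (?T (B - A))"
    using assms by (subst card_Un_disjoint [symmetric]) (auto intro: arg_cong [of _ _ card])
  ultimately show ?thesis by auto
qed

lemma odd_true_singleton: "odd (card {y \<in> {x}. \<tau> y}) = \<tau> x"
  using odd_true_insert [of "{}" x \<tau>] by simp

lemma sat_clause_unit [simp]: "sat_clause \<tau> ({x}, p) \<longleftrightarrow> \<tau> x = p"
  using odd_true_singleton [of x \<tau>] by (simp add: sat_clause_def)

lemma sat_clause_pair:
  "x \<noteq> y \<Longrightarrow> sat_clause \<tau> ({x, y}, p) \<longleftrightarrow> (\<tau> x \<noteq> \<tau> y) = p"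
  using odd_true_insert [of "{y}" x \<tau>] odd_true_insert [of "{}" y \<tau>]
  by (auto simp: sat_clause_def)

lemma odd_true_triple:
  assumes "distinct [x, y, z]"
  shows "odd (card {a \<in> {x, y, z}. \<tau> a}) = (\<tau> x \<noteq> (\<tau> y \<noteq> \<tau> z))"
  using assms odd_true_insert [of "{y, z}" x \<tau>] odd_true_insert [of "{z}" y \<tau>]
    odd_true_insert [of "{}" z \<tau>] by auto

lemma sat_clause_triple:
  "distinct [x, y, z] \<Longrightarrow> sat_clause \<tau> ({x, y, z}, p) \<longleftrightarrow> (\<tau> x \<noteq> (\<tau> y \<noteq> \<tau> z)) = p"
  using odd_true_triple [of x y z \<tau>] by (simp add: sat_clause_def)

lemma not_sat_falsum [simp]: "\<not> sat_clause \<tau> falsum"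
  by (simp add: sat_clause_def)

text \<open>Changing the value at \<open>d\<close> alone flips the parity of the whole set, so one
  of the two choices fits.\<close>

lemma set_parity_at:
  assumes "finite A" "d \<in> A"
  obtains b where "odd (card {x \<in> A. (\<tau>(d := b)) x}) = p"
proof -
  have "{y \<in> A - {d}. (\<tau>(d := b)) y} = {y \<in> A - {d}. \<tau> y}" for b by auto
  then have "odd (card {x \<in> A. (\<tau>(d := b)) x}) = (b \<noteq> odd (card {y \<in> A - {d}. \<tau> y}))" for b
    using odd_true_insert [of "A - {d}" d "\<tau>(d := b)"] assms by (simp add: insert_absorb)
  then show ?thesis by (metis (full_types) that)
qed


section \<open>Parity constraints on hypergraphs with bridges\<close>

text \<open>Each edge \<open>e\<close> has a vertex \<open>c\<close> at which the edges \<open>G\<close> are attached to the rest, i.e. the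
  incidence of \<open>e\<close> and \<open>c\<close> is a bridge of the incidence graph.\<close>
definition bridged :: "'e set \<Rightarrow> ('e \<Rightarrow> 'a set) \<Rightarrow> bool" where
  "bridged F V \<longleftrightarrow> (\<forall>e\<in>F. \<exists>c\<in>V e. \<exists>G \<subseteq> F - {e}.
     \<Union> (V ` G) \<inter> \<Union> (V ` (F - G)) \<subseteq> {c} \<and> c \<notin> \<Union> (V ` (F - G - {e})))"

text \<open>The bridge vertex \<open>c\<close> survives, with \<open>G\<close> cut down to
  \<open>F'\<close>. This makes the hypothesis available in the induction over subsets of
  edges.\<close>

lemma bridged_subset:
  assumes "bridged F V" "F' \<subseteq> F"
  shows "bridged F' V"
  unfolding bridged_def
proof
  fix e assume e: "e \<in> F'"
  then obtain c G where "c \<in> V e" "G \<subseteq> F - {e}" "\<Union> (V ` G) \<inter> \<Union> (V ` (F - G)) \<subseteq> {c}"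
    "c \<notin> \<Union> (V ` (F - G - {e}))"
    using assms unfolding bridged_def by (metis subsetD)
  then show "\<exists>c\<in>V e. \<exists>G \<subseteq> F' - {e}.
      \<Union> (V ` G) \<inter> \<Union> (V ` (F' - G)) \<subseteq> {c} \<and> c \<notin> \<Union> (V ` (F' - G - {e}))"
    using assms(2) by (intro bexI [of _ c] exI [of _ "G \<inter> F'"]) blast+
qed

text \<open>The prescribed value at \<open>r\<close> strengthens the induction: it lets the
  solutions of two halves be made to agree at the vertex they share.\<close>

lemma bridged_solvable:
  assumes "finite F" "bridged F V" "\<forall>e\<in>F. card (V e) = 3"
  shows "\<exists>\<tau>. \<tau> r = v \<and> (\<forall>e\<in>F. odd (card {x \<in> V e. \<tau> x}) = p e)"
  using assms
proof (induction F arbitrary: r v rule: finite_psubset_induct)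
  case (psubset F)
  have IH: "\<exists>\<tau>. \<tau> r = v \<and> (\<forall>e\<in>F'. odd (card {x \<in> V e. \<tau> x}) = p e)" if "F' \<subset> F" for F' r v
    using psubset.IH [OF that] bridged_subset [OF psubset.prems(1)] psubset.prems(2) that by blast
  have cong: "{x \<in> V e. \<tau> x} = {x \<in> V e. \<tau>' x}" if "\<forall>x\<in>V e. \<tau> x = \<tau>' x" for e \<tau> \<tau>'
    using that by auto
  show ?case
  \<comment> \<open>Gluing only requires that the two halves share at most \<open>c\<close>; how
    \<open>e\<close> is attached at \<open>c\<close> matters only when every \<open>G\<close> is
    empty.\<close>
  proof (cases "\<exists>e\<in>F. \<exists>c\<in>V e. \<exists>G \<subseteq> F - {e}. G \<noteq> {} \<and> \<Union> (V ` G) \<inter> \<Union> (V ` (F - G)) \<subseteq> {c}")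
    case True
    then obtain e c G where G: "e \<in> F" "G \<subseteq> F - {e}" "G \<noteq> {}"
      "\<Union> (V ` G) \<inter> \<Union> (V ` (F - G)) \<subseteq> {c}" by blast
    then have sub: "G \<subset> F" "F - G \<subset> F" by blast+
    obtain \<tau>1 \<tau>2 where \<tau>: "\<forall>e\<in>G. odd (card {x \<in> V e. \<tau>1 x}) = p e"
      "\<forall>e\<in>F - G. odd (card {x \<in> V e. \<tau>2 x}) = p e" "\<tau>1 c = \<tau>2 c"
      "if r \<in> \<Union> (V ` G) then \<tau>1 r = v else \<tau>2 r = v"
    \<comment> \<open>The half responsible for \<open>r\<close> is solved first; the other half is
      then solved with its value at \<open>c\<close> prescribed by the first solution.\<close>
    proof (cases "r \<in> \<Union> (V ` G)")
      case True
      obtain \<tau>1 where "\<tau>1 r = v" "\<forall>e\<in>G. odd (card {x \<in> V e. \<tau>1 x}) = p e"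
        using IH [OF sub(1)] by metis
      moreover obtain \<tau>2 where "\<tau>2 c = \<tau>1 c" "\<forall>e\<in>F - G. odd (card {x \<in> V e. \<tau>2 x}) = p e"
        using IH [OF sub(2)] by metis
      ultimately show ?thesis using that True by simp
    next
      case False
      obtain \<tau>2 where "\<tau>2 r = v" "\<forall>e\<in>F - G. odd (card {x \<in> V e. \<tau>2 x}) = p e"
        using IH [OF sub(2)] by metis
      moreover obtain \<tau>1 where "\<tau>1 c = \<tau>2 c" "\<forall>e\<in>G. odd (card {x \<in> V e. \<tau>1 x}) = p e"
        using IH [OF sub(1)] by metis
      ultimately show ?thesis using that False by simp
    qed
    define \<tau> where "\<tau> = (\<lambda>x. if x \<in> \<Union> (V ` G) then \<tau>1 x else \<tau>2 x)"
    have "odd (card {x \<in> V e. \<tau> x}) = p e" if "e \<in> F" for e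
    proof (cases "e \<in> G")
      case True
      then have "\<forall>x\<in>V e. \<tau> x = \<tau>1 x" by (auto simp: \<tau>_def)
      then show ?thesis using \<tau>(1) True cong [of e \<tau> \<tau>1] by auto
    next
      case False
      then have "\<forall>x\<in>V e. \<tau> x = \<tau>2 x" using G(4) \<tau>(3) that by (auto simp: \<tau>_def)
      then show ?thesis using \<tau>(2) False that cong [of e \<tau> \<tau>2] by auto
    qed
    moreover have "\<tau> r = v" using \<tau>(4) by (auto simp: \<tau>_def split: if_splits)
    ultimately show ?thesis by blast
  next
    case False
    \<comment> \<open>With \<open>G\<close> empty, the second bridge condition says that
      \<open>c\<close> lies in no edge other than \<open>e\<close>.\<close>
    have own_vertex: "\<exists>c\<in>V e. c \<notin> \<Union> (V ` (F - {e}))" if "e \<in> F" for e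
    proof -
      obtain c G where c: "c \<in> V e" "G \<subseteq> F - {e}" "\<Union> (V ` G) \<inter> \<Union> (V ` (F - G)) \<subseteq> {c}"
        "c \<notin> \<Union> (V ` (F - G - {e}))"
        using psubset.prems(1) \<open>e \<in> F\<close> unfolding bridged_def by metis
      with False that have "G = {}" by blast
      with c show ?thesis by auto
    qed
    show ?thesis
    proof (cases "F = {}")
      case True
      then show ?thesis by auto
    next
      case False
      then obtain e where e: "e \<in> F" by blast
      \<comment> \<open>Two distinct edges have distinct private vertices, so one of these differs from \<open>r\<close>.\<close>
      obtain f d where f: "f \<in> F" "d \<in> V f" "d \<noteq> r" "d \<notin> \<Union> (V ` (F - {f}))"
      proof (cases "F = {e}")
        case True
        have "\<not> V e \<subseteq> {r}" using psubset.prems(2) e card_mono [of "{r}" "V e"] by auto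
        then show ?thesis using that True by auto
      next
        case False
        then obtain f where f: "f \<in> F" "f \<noteq> e" using e by blast
        obtain c where c: "c \<in> V e" "c \<notin> \<Union> (V ` (F - {e}))" using own_vertex [OF e] by blast
        obtain d where d: "d \<in> V f" "d \<notin> \<Union> (V ` (F - {f}))" using own_vertex [OF f(1)] by blast
        have "c \<noteq> d" using c d e f by blast
        then show ?thesis using that [OF e c(1) _ c(2)] that [OF f(1) d(1) _ d(2)] by blast
      qed
      \<comment> \<open>All edges except \<open>f\<close> are solved first; \<open>f\<close> is then
        repaired at its private vertex \<open>d\<close>, which disturbs neither the other edges nor
        \<open>r\<close>.\<close>
      obtain \<tau> where \<tau>: "\<tau> r = v" "\<forall>e\<in>F - {f}. odd (card {x \<in> V e. \<tau> x}) = p e"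
        using IH [of "F - {f}"] f(1) by blast
      have "finite (V f)" using psubset.prems(2) f(1) by (metis card.infinite zero_neq_numeral)
      then obtain b where b: "odd (card {x \<in> V f. (\<tau>(d := b)) x}) = p f"
        using f(2) set_parity_at by metis
      have "odd (card {x \<in> V e. (\<tau>(d := b)) x}) = p e" if "e \<in> F" for e
      proof (cases "e = f")
        case True
        with b show ?thesis by simp
      next
        case False
        then have "\<forall>x\<in>V e. (\<tau>(d := b)) x = \<tau> x" using f(4) that by auto
        then show ?thesis using \<tau>(2) that False cong [of e "\<tau>(d := b)" \<tau>] by auto
      qed
      then show ?thesis using \<tau>(1) f(3) by (intro exI [of _ "\<tau>(d := b)"]) auto
    qed
  qed
qed


section \<open>Bridges from cycle-partitionability\<close>

definition adjacency :: "'v xor_clause set \<Rightarrow> ('v \<times> 'v) set" where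
  "adjacency \<psi> = {(u, v). \<exists>C\<in>\<psi>. u \<in> fst C \<and> v \<in> fst C}"

lemma sym_adjacency: "sym (adjacency \<psi>)"
  unfolding adjacency_def sym_def by blast

lemma card_3_remaining:
  assumes "card A = 3" "u \<in> A" "v \<in> A" "u \<noteq> v"
  obtains w where "A = {u, v, w}" "w \<noteq> u" "w \<noteq> v"
proof -
  have "finite A" using assms(1) by (metis card.infinite zero_neq_numeral)
  then have "card (A - {u, v}) = 1" using assms by (simp add: card_Diff_subset)
  then obtain w where "A - {u, v} = {w}" using card_1_singletonE by blast
  then show ?thesis using that assms by (metis Diff_iff Diff_partition Un_insert_left insertCI insert_subset sup_bot_left empty_subsetI)
qed

text \<open>Two variables determine the clause containing both, which later rules out cycles of only
  two clauses.\<close>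

lemma three_xor_nf_unique:
  assumes "three_xor_nf \<phi>" "C \<in> \<phi>" "D \<in> \<phi>" "u \<noteq> v" "{u, v} \<subseteq> fst C" "{u, v} \<subseteq> fst D"
  shows "C = D"
proof (rule ccontr)
  assume "C \<noteq> D"
  then have "card (fst C \<inter> fst D) \<le> 1" using assms unfolding three_xor_nf_def by blast
  moreover have "finite (fst C)"
    using assms(1,2) unfolding three_xor_nf_def by (metis card.infinite zero_neq_numeral)
  then have "card {u, v} \<le> card (fst C \<inter> fst D)" using assms by (intro card_mono) auto
  ultimately show False using \<open>u \<noteq> v\<close> by simp
qed

text \<open>A shortest path from \<open>u\<close> to \<open>v\<close> avoiding \<open>e\<close> is
  closed by \<open>e\<close> to an xor-cycle. Minimality makes its vertices and its clauses
  distinct, and the third variable of \<open>e\<close> becomes an outer variable.\<close>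

lemma connected_imp_xor_cycle:
  assumes nf: "three_xor_nf \<phi>" and e: "e \<in> \<phi>" "u \<in> fst e" "v \<in> fst e" "u \<noteq> v"
    and conn: "(u, v) \<in> (adjacency (\<phi> - {e}))\<^sup>*"
  obtains xs ys ps where "xor_cycle \<phi> xs ys ps" "u \<in> set xs" "v \<in> set xs" "fst e \<subseteq> {u, v} \<union> set ys"
proof -
  let ?R = "adjacency (\<phi> - {e})"
  define n where "n = (LEAST n. (u, v) \<in> ?R ^^ n)"
  have n: "(u, v) \<in> ?R ^^ n"
    using conn unfolding n_def by (metis LeastI rtrancl_imp_relpow)
  have least: "n \<le> m" if "(u, v) \<in> ?R ^^ m" for m
    using that unfolding n_def by (rule Least_le)
  obtain f where f: "f 0 = u" "f n = v" "\<And>i. i < n \<Longrightarrow> (f i, f (Suc i)) \<in> ?R"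
    using n by (auto simp: relpow_fun_conv)
  have path: "(f i, f (i + k)) \<in> ?R ^^ k" if "i + k \<le> n" for i k
    using f(3) that by (auto simp: relpow_fun_conv intro: exI [of _ "\<lambda>j. f (i + j)"])
  \<comment> \<open>Replacing the part of the path between \<open>f i\<close> and \<open>f j\<close>
    by \<open>m\<close> steps gives a walk from \<open>u\<close> to \<open>v\<close>, which cannot
    be shorter than \<open>n\<close>.\<close>
  have no_shortcut: "j - i \<le> m" if "i \<le> j" "j \<le> n" "(f i, f j) \<in> ?R ^^ m" for i j m
  proof -
    have "(u, f i) \<in> ?R ^^ i" "(f j, v) \<in> ?R ^^ (n - j)"
      using path [of 0 i] path [of j "n - j"] that f(1,2) by auto
    then have "(u, v) \<in> ?R ^^ (i + m + (n - j))"
      using relpow_trans [OF relpow_trans, OF _ that(3)] by blast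
    then show ?thesis using least that by fastforce
  qed
  have f_inj: "i = j" if "i \<le> n" "j \<le> n" "f i = f j" for i j
    using that
  proof (induction i j rule: linorder_wlog)
    case (le i j)
    then show ?case using no_shortcut [of i j 0] by simp
  qed simp
  have "\<exists>C\<in>\<phi> - {e}. f i \<in> fst C \<and> f (Suc i) \<in> fst C" if "i < n" for i
    using f(3) [OF that] by (auto simp: adjacency_def)
  then obtain g where g: "\<And>i. i < n \<Longrightarrow> g i \<in> \<phi> - {e} \<and> f i \<in> fst (g i) \<and> f (Suc i) \<in> fst (g i)"
    by metis
  \<comment> \<open>A clause used at steps \<open>i\<close> and \<open>j\<close> would link
    \<open>f i\<close> to \<open>f (Suc j)\<close> in one step.\<close>
  have g_inj: "i = j" if "i < n" "j < n" "g i = g j" for i j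
    using that
  proof (induction i j rule: linorder_wlog)
    case (le i j)
    then have "(f i, f (Suc j)) \<in> ?R ^^ 1" using g [of i] g [of j] by (auto simp: adjacency_def)
    then have "Suc j - i \<le> 1" using le by (intro no_shortcut) auto
    with le show ?case by simp
  qed simp
  have "n \<noteq> 0" using f e(4) by metis
  \<comment> \<open>A single clause joining \<open>u\<close> and \<open>v\<close> would share two
    variables with \<open>e\<close> and hence equal \<open>e\<close>.\<close>
  moreover have "n \<noteq> 1"
    using g [of 0] f(1,2) three_xor_nf_unique [OF nf _ e(1) e(4), of "g 0"] e by auto
  ultimately have n2: "n \<ge> 2" by linarith
  \<comment> \<open>The cycle has \<open>Suc n\<close> clauses: the \<open>n\<close> path clauses
    and, at position \<open>n\<close>, the closing clause \<open>e\<close>; \<open>s\<close> is the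
    cyclic successor.\<close>
  define h where "h i = (if i < n then g i else e)" for i
  define s where "s i = Suc i mod Suc n" for i
  have s: "s i = (if i < n then Suc i else 0)" if "i < Suc n" for i
    using that by (cases "i = n") (auto simp: s_def)
  have h: "h i \<in> \<phi> \<and> f i \<in> fst (h i) \<and> f (s i) \<in> fst (h i) \<and> f i \<noteq> f (s i)" if "i < Suc n" for i
    using that g [of i] e f(1,2) f_inj [of i "Suc i"] s [OF that]
    by (cases "i < n") (auto simp: h_def less_Suc_eq)
  have "\<exists>w. fst (h i) = {f i, f (s i), w} \<and> w \<noteq> f i \<and> w \<noteq> f (s i)" if "i < Suc n" for i
    using h [OF that] nf card_3_remaining unfolding three_xor_nf_def by metis
  then obtain y where y: "\<And>i. i < Suc n \<Longrightarrow>
      fst (h i) = {f i, f (s i), y i} \<and> y i \<noteq> f i \<and> y i \<noteq> f (s i)"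
    by metis
  define xs ys ps where "xs = map f [0..<Suc n]" and "ys = map y [0..<Suc n]"
    and "ps = map (snd \<circ> h) [0..<Suc n]"
  note defs = xs_def ys_def ps_def
  have len: "length xs = Suc n" "length ys = Suc n" "length ps = Suc n" by (simp_all add: defs)
  have nth: "xs ! i = f i" "ys ! i = y i" "ps ! i = snd (h i)" if "i < Suc n" for i
    using that by (simp_all add: defs del: upt_Suc)
  have s_less: "s i < Suc n" for i by (simp add: s_def)
  have clause: "cycle_clause xs ys ps i = h i" if "i < Suc n" for i
    using y [OF that] nth [OF that] nth(1) [OF s_less]
    by (simp add: cycle_clause_def len prod_eq_iff flip: s_def)
  have "h i = h j \<Longrightarrow> i = j" if "i < Suc n" "j < Suc n" for i j
    using that g [of i] g [of j] g_inj [of i j] by (auto simp: h_def less_Suc_eq split: if_splits)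
  then have "inj_on (cycle_clause xs ys ps) {..<length xs}"
    using clause by (auto simp: inj_on_def len)
  moreover have "distinct xs"
    using f_inj by (auto simp: xs_def distinct_map inj_on_def simp del: upt_Suc)
  ultimately have "xor_cycle \<phi> xs ys ps"
    using n2 y nth nth(1) [OF s_less] clause h
    by (auto simp: xor_cycle_def len simp flip: s_def)
  moreover have "u \<in> set xs" unfolding xs_def set_map using f(1) by (intro image_eqI [of _ _ 0]) auto
  moreover have "v \<in> set xs" unfolding xs_def set_map using f(2) by (intro image_eqI [of _ _ n]) auto
  moreover have "fst e \<subseteq> {u, v} \<union> set ys"
    using y [of n] s [of n] f(1,2) by (auto simp: h_def ys_def)
  ultimately show ?thesis using that by blast
qed

lemma clause_has_bridge:
  assumes nf: "three_xor_nf \<phi>" and part: "cycle_partitionable \<phi>" and e: "e \<in> \<phi>"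
  shows "\<exists>c\<in>fst e. \<forall>u\<in>fst e. u \<noteq> c \<longrightarrow> (c, u) \<notin> (adjacency (\<phi> - {e}))\<^sup>*"
proof (rule ccontr)
  assume not_ex: "\<not> ?thesis"
  then have conn: "\<exists>u\<in>fst e. u \<noteq> c \<and> (c, u) \<in> (adjacency (\<phi> - {e}))\<^sup>*" if "c \<in> fst e" for c
    using that not_ex by blast
  obtain I O' where "I \<union> O' = vars \<phi> \<and> I \<inter> O' = {} \<and>
      (\<forall>xs ys ps. xor_cycle \<phi> xs ys ps \<longrightarrow> set xs \<subseteq> I \<and> set ys \<subseteq> O')"
    using part unfolding cycle_partitionable_def by (elim exE)
  then have IO: "I \<inter> O' = {}"
    "\<forall>xs ys ps. xor_cycle \<phi> xs ys ps \<longrightarrow> set xs \<subseteq> I \<and> set ys \<subseteq> O'" by simp_all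
  have cyc: "c \<in> I \<and> (\<exists>u. fst e \<subseteq> {c, u} \<union> O')" if "c \<in> fst e" for c
  proof -
    obtain u where u: "u \<in> fst e" "c \<noteq> u" "(c, u) \<in> (adjacency (\<phi> - {e}))\<^sup>*"
      using conn \<open>c \<in> fst e\<close> by blast
    obtain xs ys ps where
      "xor_cycle \<phi> xs ys ps" "c \<in> set xs" "u \<in> set xs" "fst e \<subseteq> {c, u} \<union> set ys"
      by (rule connected_imp_xor_cycle [OF nf e \<open>c \<in> fst e\<close> u])
    with IO(2) have "set xs \<subseteq> I" "set ys \<subseteq> O'" by auto
    with \<open>c \<in> set xs\<close> \<open>fst e \<subseteq> _\<close> show ?thesis by blast
  qed
  have card: "card (fst e) = 3" using nf e unfolding three_xor_nf_def by blast
  then obtain c where c: "c \<in> fst e" by fastforce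
  then obtain u where u: "fst e \<subseteq> {c, u} \<union> O'" using cyc by meson
  have "fst e \<subseteq> I" using cyc by auto
  \<comment> \<open>All variables of \<open>e\<close> are inner, so none can be the outer third
    variable, and only two are left.\<close>
  with u IO(1) have "fst e \<subseteq> {c, u}" by blast
  then have "card (fst e) \<le> card {c, u}" by (intro card_mono) auto
  also have "\<dots> \<le> 2" by (simp add: card_insert_if)
  finally show False using card by simp
qed

section \<open>Models from saturated clause sets\<close>

text \<open>Walks in the graph whose edges are the binary clauses of \<open>B\<close>; the last
  argument is the exclusive or of the edge labels, i.e. the value that the walk forces on the
  exclusive or of its ends.\<close>

inductive parity_walk :: "'v xor_clause set \<Rightarrow> 'v \<Rightarrow> 'v \<Rightarrow> bool \<Rightarrow> bool" for B where
  refl: "parity_walk B v v False"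
| step: "parity_walk B v w p \<Longrightarrow> w \<noteq> u \<Longrightarrow> ({w, u}, q) \<in> B \<Longrightarrow> parity_walk B v u (p \<noteq> q)"

lemma parity_walk_edge:
  assumes "v \<noteq> w" "({v, w}, q) \<in> B"
  shows "parity_walk B v w q"
  using parity_walk.step [OF parity_walk.refl assms] by simp

text \<open>The second leg comes first among the assumptions because the induction runs over
  it.\<close>

lemma parity_walk_trans:
  assumes "parity_walk B w u q" "parity_walk B v w p"
  shows "parity_walk B v u (p \<noteq> q)"
  using assms
proof induction
  case (step w x q u r)
  have assoc: "(p \<noteq> (q \<noteq> r)) = ((p \<noteq> q) \<noteq> r)" by auto
  show ?case unfolding assoc by (rule parity_walk.step) (use step in auto)
qed simp

lemma parity_walk_sym:
  assumes "parity_walk B v w p"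
  shows "parity_walk B w v p"
  using assms
proof induction
  case (step v w p u q)
  then have "parity_walk B u w q" by (intro parity_walk_edge) (auto simp: insert_commute)
  from parity_walk_trans [OF step.IH this] show ?case by (simp add: eq_commute)
qed (rule parity_walk.refl)

lemma parity_walk_mono:
  assumes "parity_walk B v w p" "B \<subseteq> B'"
  shows "parity_walk B' v w p"
  using assms by induction (blast intro: parity_walk.intros)+

text \<open>The common interface of the two proof systems: the model construction uses only these
  closure properties of the derivable clauses, in the case where the empty clause is not
  derivable.\<close>

locale saturated =
  fixes S :: "'v xor_clause set"
  assumes unit_consistent: "({x}, True) \<in> S \<Longrightarrow> ({x}, False) \<notin> S"
    and unit_pair: "x \<noteq> y \<Longrightarrow> ({x}, a) \<in> S \<Longrightarrow> ({x, y}, b) \<in> S \<Longrightarrow> ({y}, a \<noteq> b) \<in> S"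
    and unit_triple:
      "distinct [x, y, z] \<Longrightarrow> ({x}, a) \<in> S \<Longrightarrow> ({x, y, z}, b) \<in> S \<Longrightarrow> ({y, z}, a \<noteq> b) \<in> S"
    and walk_triple:
      "distinct [x, y, z] \<Longrightarrow> parity_walk S x y p \<Longrightarrow> ({x, y, z}, d) \<in> S \<Longrightarrow> ({z}, p \<noteq> d) \<in> S"
    and closed_walk: "parity_walk S x x p \<Longrightarrow> \<not> p"
begin

lemma model_exists:
  assumes fin: "finite \<phi>" and nf: "three_xor_nf \<phi>" and part: "cycle_partitionable \<phi>"
    and sub: "\<phi> \<subseteq> S" "U \<subseteq> S" and units: "\<And>C. C \<in> U \<Longrightarrow> \<exists>y a. C = ({y}, a)"
    and x: "({x}, \<not> b) \<notin> S"
  shows "\<exists>\<tau>. satisfies \<tau> (\<phi> \<union> U) \<and> \<tau> x = b"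
proof -
  \<comment> \<open>\<open>A\<close> contains the variables fixed by unit clauses, and \<alpha>
    gives their values.\<close>
  define A where "A = {v. \<exists>a. ({v}, a) \<in> S}"
  define \<alpha> where "\<alpha> v \<longleftrightarrow> ({v}, True) \<in> S" for v
  have assigned: "v \<in> A" "\<alpha> v = a" if "({v}, a) \<in> S" for v a
    using that unit_consistent by (cases a; auto simp: A_def \<alpha>_def)+
  have \<alpha>: "({v}, \<alpha> v) \<in> S" if "v \<in> A" for v
    using that assigned(2) by (auto simp: A_def)
  \<comment> \<open>Only binary clauses arising from clauses of \<phi> with exactly one assigned
    variable are taken, not all those in \<open>S\<close>. Thus each edge of an equivalence class
    can be traced back to a clause of \<phi>.\<close>
  define B where "B = {({y, z}, a \<noteq> c) | x y z a c.
    distinct [x, y, z] \<and> ({x}, a) \<in> S \<and> ({x, y, z}, c) \<in> \<phi> \<and> y \<notin> A \<and> z \<notin> A}"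
  have "B \<subseteq> S"
    using unit_triple sub(1) unfolding B_def by blast
  define T where "T = {(v, w). \<exists>p. parity_walk B v w p}"
  have T_refl: "(v, v) \<in> T" for v
    unfolding T_def by (auto intro!: exI parity_walk.refl)
  have T_sym: "(w, v) \<in> T" if "(v, w) \<in> T" for v w
    using that by (auto simp: T_def dest: parity_walk_sym)
  have T_trans: "(v, u) \<in> T" if "(v, w) \<in> T" "(w, u) \<in> T" for v w u
    using that by (auto simp: T_def dest: parity_walk_trans)
  define rep where "rep v = (SOME w. (v, w) \<in> T)" for v
  have rep: "(v, rep v) \<in> T" for v
    unfolding rep_def using T_refl by (rule someI)
  have rep_eq: "rep v = rep w" if "(v, w) \<in> T" for v w
  proof -
    have "(v, u) \<in> T \<longleftrightarrow> (w, u) \<in> T" for u using that T_sym T_trans by blast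
    then show ?thesis by (simp add: rep_def)
  qed
  have rep_eqD: "(v, w) \<in> T" if "rep v = rep w" for v w
    using T_trans [OF rep [of v], of w] T_sym [OF rep [of w]] that by simp
  \<comment> \<open>\<sigma> is the value of a variable relative to its representative; by
    \<open>closed_walk\<close> it does not depend on the walk chosen.\<close>
  define \<sigma> where "\<sigma> v = (SOME p. parity_walk B v (rep v) p)" for v
  have \<sigma>: "parity_walk B v (rep v) (\<sigma> v)" for v
  proof -
    obtain p where "parity_walk B v (rep v) p" using rep [of v] by (auto simp: T_def)
    then show ?thesis unfolding \<sigma>_def by (rule someI)
  qed
  have walk_unique: "p = q" if "parity_walk B v w p" "parity_walk B v w q" for v w p q
  proof -
    have "parity_walk S v v (p \<noteq> q)"
      using parity_walk_mono [OF parity_walk_trans [OF parity_walk_sym [OF that(2)] that(1)] \<open>B \<subseteq> S\<close>] .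
    from closed_walk [OF this] show ?thesis by simp
  qed
  have \<sigma>_edge: "rep v = rep w" "(\<sigma> v \<noteq> \<sigma> w) = q" if "({v, w}, q) \<in> B" "v \<noteq> w" for v w q
  proof -
    have walk: "parity_walk B v w q" using that by (intro parity_walk_edge)
    then show "rep v = rep w" by (intro rep_eq) (auto simp: T_def)
    then have "\<sigma> v = (q \<noteq> \<sigma> w)"
      using walk_unique [OF \<sigma> [of v]] parity_walk_trans [OF \<sigma> [of w] walk] by simp
    then show "(\<sigma> v \<noteq> \<sigma> w) = q" by auto
  qed
  define R where "R = {e \<in> \<phi>. fst e \<inter> A = {}}"
  have card3: "card (fst e) = 3" if "e \<in> \<phi>" for e
    using nf that unfolding three_xor_nf_def by blast
  \<comment> \<open>If two variables of \<open>e\<close> were equivalent, \<open>walk_triple\<close>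
    would assign the third, but clauses in \<open>R\<close> have no assigned variable.\<close>
  have inj: "inj_on rep (fst e)" if e: "e \<in> R" for e
  proof (rule inj_onI, rule ccontr)
    fix v w assume vw: "v \<in> fst e" "w \<in> fst e" "rep v = rep w" "v \<noteq> w"
    then obtain z where z: "fst e = {v, w, z}" "z \<noteq> v" "z \<noteq> w"
      using card_3_remaining card3 e unfolding R_def by (metis (no_types, lifting) mem_Collect_eq)
    obtain p where "parity_walk S v w p"
      using rep_eqD [OF vw(3)] parity_walk_mono [OF _ \<open>B \<subseteq> S\<close>] by (auto simp: T_def)
    moreover have "({v, w, z}, snd e) \<in> S"
      using e sub(1) z(1) unfolding R_def by (metis (no_types, lifting) mem_Collect_eq prod.collapse subsetD)
    ultimately have "z \<in> A" using walk_triple [of v w z p] assigned(1) z vw(4) by auto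
    then show False using e z(1) by (auto simp: R_def)
  qed
  \<comment> \<open>A clause behind an edge of \<open>B\<close> contains an assigned variable, so it
    is not \<open>e\<close>. Hence contracting equivalence classes creates no connection that is
    absent from \<phi> without \<open>e\<close>.\<close>
  have T_connected: "T \<subseteq> (adjacency (\<phi> - {e}))\<^sup>*" if e: "e \<in> R" for e
  proof -
    have edge: "(v, w) \<in> adjacency (\<phi> - {e})" if "({v, w}, q) \<in> B" for v w q
    proof -
      from that obtain x y z a c where
        *: "({x}, a) \<in> S" "({x, y, z}, c) \<in> \<phi>" "{v, w} = {y, z}"
        unfolding B_def by blast
      then have "({x, v, w}, c) \<in> \<phi>" by simp
      moreover from this have "({x, v, w}, c) \<noteq> e" using e assigned(1) [OF *(1)] by (auto simp: R_def)
      ultimately show ?thesis by (force simp: adjacency_def)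
    qed
    have "(v, w) \<in> (adjacency (\<phi> - {e}))\<^sup>*" if "parity_walk B v w p" for v w p
      using that by induction (auto intro: rtrancl_into_rtrancl edge)
    then show ?thesis by (auto simp: T_def)
  qed
  have "bridged R (\<lambda>e. rep ` fst e)"
    unfolding bridged_def
  proof
    fix e assume e: "e \<in> R"
    then have "e \<in> \<phi>" by (simp add: R_def)
    from clause_has_bridge [OF nf part this] obtain c where c: "c \<in> fst e"
      "\<forall>u\<in>fst e. u \<noteq> c \<longrightarrow> (c, u) \<notin> (adjacency (\<phi> - {e}))\<^sup>*"
      by (elim bexE)
    let ?K = "(adjacency (\<phi> - {e}))\<^sup>*"
    \<comment> \<open>\<open>G\<close> consists of the clauses of \<open>R\<close> on the side of
      \<open>c\<close> once \<open>e\<close> is removed.\<close>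
    define G where "G = {f \<in> R - {e}. \<exists>u\<in>fst f. (c, u) \<in> ?K}"
    have K_sym: "(w, v) \<in> ?K" if "(v, w) \<in> ?K" for v w
      using that sym_rtrancl [OF sym_adjacency] by (rule symD [rotated])
    have K_rep: "(c, rep u) \<in> ?K \<longleftrightarrow> (c, u) \<in> ?K" for u
    proof -
      have "(u, rep u) \<in> ?K" using rep [of u] T_connected [OF e] by (rule subsetD [rotated])
      with K_sym [OF this] show ?thesis
        using rtrancl_trans [of c u _ "rep u"] rtrancl_trans [of c "rep u" _ u] by blast
    qed
    have inside: "(c, u) \<in> ?K" if f: "f \<in> G" "u \<in> fst f" for f u
    proof -
      obtain u' where "u' \<in> fst f" and u': "(c, u') \<in> ?K" using f(1) by (auto simp: G_def)
      have "(u', u) \<in> adjacency (\<phi> - {e})"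
        using f \<open>u' \<in> fst f\<close> by (auto simp: adjacency_def G_def R_def)
      with u' show ?thesis by (rule rtrancl_into_rtrancl)
    qed
    \<comment> \<open>The clause \<open>e\<close> itself lies in \<open>R - G\<close>, and by the
      choice of \<open>c\<close> it meets the component of \<open>c\<close> only in
      \<open>c\<close>.\<close>
    have outside: "(c, u) \<notin> ?K" if "f \<in> R - G" "u \<in> fst f" "f = e \<longrightarrow> u \<noteq> c" for f u
      using that c(2) by (cases "f = e") (auto simp: G_def)
    have "\<Union> ((\<lambda>e. rep ` fst e) ` G) \<inter> \<Union> ((\<lambda>e. rep ` fst e) ` (R - G)) \<subseteq> {rep c}"
    proof
      fix t assume "t \<in> \<Union> ((\<lambda>e. rep ` fst e) ` G) \<inter> \<Union> ((\<lambda>e. rep ` fst e) ` (R - G))"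
      then obtain f g u w where "f \<in> G" "u \<in> fst f" "t = rep u" "g \<in> R - G" "w \<in> fst g" "t = rep w"
        by auto
      with inside [of f u] outside [of g w] K_rep [of u] K_rep [of w] have "w = c"
        by metis
      with \<open>t = rep w\<close> show "t \<in> {rep c}" by simp
    qed
    moreover have "rep c \<notin> \<Union> ((\<lambda>e. rep ` fst e) ` (R - G - {e}))"
    proof
      assume "rep c \<in> \<Union> ((\<lambda>e. rep ` fst e) ` (R - G - {e}))"
      then obtain f where f: "f \<in> R - G" "f \<noteq> e" "rep c \<in> rep ` fst f" by blast
      then obtain u where "u \<in> fst f" "rep c = rep u" by blast
      with f outside [of f u] K_rep [of u] K_rep [of c] show False by auto
    qed
    moreover have "G \<subseteq> R - {e}" by (auto simp: G_def)
    ultimately show "\<exists>c\<in>rep ` fst e. \<exists>G \<subseteq> R - {e}.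
        \<Union> ((\<lambda>e. rep ` fst e) ` G) \<inter> \<Union> ((\<lambda>e. rep ` fst e) ` (R - G)) \<subseteq> {c} \<and>
        c \<notin> \<Union> ((\<lambda>e. rep ` fst e) ` (R - G - {e}))"
      using c(1) by blast
  qed
  moreover have "finite R" using fin by (simp add: R_def)
  moreover have "\<forall>e\<in>R. card (rep ` fst e) = 3"
    using inj card3 by (auto simp: card_image R_def)
  \<comment> \<open>\<rho> chooses one value per class. Right-hand sides and the value at
    \<open>rep x\<close> are shifted by \<sigma>, since an unassigned \<open>v\<close> will receive
    the exclusive or of \<open>\<sigma> v\<close> and \<open>\<rho> (rep v)\<close>.\<close>
  ultimately obtain \<rho> where \<rho>: "\<rho> (rep x) = (b \<noteq> \<sigma> x)"
    "\<And>e. e \<in> R \<Longrightarrow>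
      odd (card {y \<in> rep ` fst e. \<rho> y}) = (snd e \<noteq> odd (card {v \<in> fst e. \<sigma> v}))"
    using bridged_solvable [of R "\<lambda>e. rep ` fst e" "rep x" "b \<noteq> \<sigma> x"
        "\<lambda>e. snd e \<noteq> odd (card {v \<in> fst e. \<sigma> v})"] by blast
  define \<tau> where "\<tau> v = (if v \<in> A then \<alpha> v else \<sigma> v \<noteq> \<rho> (rep v))" for v
  have "sat_clause \<tau> e" if e: "e \<in> \<phi>" for e
  proof (cases "e \<in> R")
    case True
    have "{y \<in> rep ` fst e. \<rho> y} = rep ` {v \<in> fst e. \<rho> (rep v)}" by auto
    moreover have "inj_on rep {v \<in> fst e. \<rho> (rep v)}"
      using inj [OF True] by (rule inj_on_subset) auto
    ultimately have \<rho>_parity: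
      "odd (card {v \<in> fst e. \<rho> (rep v)}) = (snd e \<noteq> odd (card {v \<in> fst e. \<sigma> v}))"
      using \<rho>(2) [OF True] by (simp add: card_image)
    obtain u v w where uvw: "fst e = {u, v, w}" "distinct [u, v, w]"
      using card3 [OF e] by (auto simp: card_3_iff)
    have "u \<notin> A" "v \<notin> A" "w \<notin> A" using True uvw(1) by (auto simp: R_def)
    then have "odd (card {a \<in> fst e. \<tau> a}) =
        (odd (card {a \<in> fst e. \<sigma> a}) \<noteq> odd (card {a \<in> fst e. \<rho> (rep a)}))"
      unfolding uvw(1) odd_true_triple [OF uvw(2)] by (simp add: \<tau>_def) blast
    then show ?thesis unfolding sat_clause_def \<rho>_parity by auto
  next
    case False
    \<comment> \<open>An assigned variable reduces the clause to a binary one in \<open>S\<close>: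
      either its two remaining variables are both assigned consistently by \<open>unit_pair\<close>,
      or it is an edge of \<open>B\<close> and \<sigma> respects it.\<close>
    then obtain u where u: "u \<in> fst e" "u \<in> A" using e by (auto simp: R_def)
    have "card (fst e - {u}) = 2" using card3 [OF e] u(1) by simp
    then obtain v w where *: "fst e - {u} = {v, w}" "v \<noteq> w" by (auto simp: card_2_iff)
    then have vw: "fst e = {u, v, w}" "distinct [u, v, w]" using u(1) by auto
    then have e_in: "({u, v, w}, snd e) \<in> \<phi>" using e by (metis prod.collapse)
    then have vw_S: "({v, w}, \<alpha> u \<noteq> snd e) \<in> S"
      using unit_triple [OF vw(2) \<alpha> [OF u(2)]] sub(1) by blast
    have "(\<tau> v \<noteq> \<tau> w) = (\<alpha> u \<noteq> snd e)"
    proof (cases "v \<in> A \<or> w \<in> A")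
      case True
      then show ?thesis
      proof
        assume v: "v \<in> A"
        then have "({w}, \<alpha> v \<noteq> (\<alpha> u \<noteq> snd e)) \<in> S"
          using unit_pair [OF _ \<alpha> vw_S] vw(2) by simp
        then show ?thesis using assigned v by (auto simp: \<tau>_def)
      next
        assume w: "w \<in> A"
        have "({w, v}, \<alpha> u \<noteq> snd e) \<in> S" using vw_S by (subst insert_commute)
        from unit_pair [OF _ \<alpha> this] w have "({v}, \<alpha> w \<noteq> (\<alpha> u \<noteq> snd e)) \<in> S"
          using vw(2) by auto
        then show ?thesis using assigned w by (auto simp: \<tau>_def)
      qed
    next
      case False
      then have "({v, w}, \<alpha> u \<noteq> snd e) \<in> B"
        unfolding B_def using e_in vw(2) \<alpha> [OF u(2)] by blast
      from \<sigma>_edge [OF this] vw(2) False show ?thesis by (auto simp: \<tau>_def)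
    qed
    then show ?thesis
      using odd_true_triple [OF vw(2), of \<tau>] u(2) unfolding sat_clause_def vw(1) \<tau>_def by auto
  qed
  moreover have "sat_clause \<tau> C" if "C \<in> U" for C
    using units [OF that] that sub(2) assigned by (auto simp: \<tau>_def)
  moreover have "\<tau> x = b"
  proof (cases "x \<in> A")
    case True
    then show ?thesis using \<alpha> [OF True] x by (cases b; cases "\<alpha> x") (auto simp: \<tau>_def)
  next
    case False
    then show ?thesis using \<rho>(1) by (auto simp: \<tau>_def)
  qed
  ultimately show ?thesis unfolding satisfies_def by blast
qed

end


section \<open>Closure and soundness of derivability\<close>

lemma derivable_premise:
  assumes "C \<in> \<psi>"
  shows "derivable S \<psi> C"
  unfolding derivable_def derivation_def using assms by (intro exI [of _ "[C]"]) simp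

lemma derivation_append:
  assumes "derivation S \<psi> Cs" "derivation S \<psi> Ds"
  shows "derivation S \<psi> (Cs @ Ds)"
  unfolding derivation_def
proof (intro allI impI)
  fix i assume i: "i < length (Cs @ Ds)"
  show "(Cs @ Ds) ! i \<in> \<psi> \<or> (\<exists>P \<subseteq> set (take i (Cs @ Ds)). S P ((Cs @ Ds) ! i))"
  proof (cases "i < length Cs")
    case True
    then show ?thesis using assms(1) by (simp add: derivation_def nth_append)
  next
    case False
    with i have "Ds ! (i - length Cs) \<in> \<psi> \<or>
        (\<exists>P \<subseteq> set (take (i - length Cs) Ds). S P (Ds ! (i - length Cs)))"
      using assms(2) unfolding derivation_def by simp
    then show ?thesis using False by (auto simp: nth_append)
  qed
qed

text \<open>Derivations of the finitely many premises are concatenated and the conclusion is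
  appended.\<close>

lemma derivable_inference:
  assumes "S P D" "finite P" "\<And>C. C \<in> P \<Longrightarrow> derivable S \<psi> C"
  shows "derivable S \<psi> D"
proof -
  have "\<exists>Ds. derivation S \<psi> Ds \<and> P \<subseteq> set Ds"
    using assms(2,3)
  proof (induction P)
    case empty
    show ?case by (intro exI [of _ "[]"]) (simp add: derivation_def)
  next
    case (insert C P)
    then obtain Cs Ds where "derivation S \<psi> Cs" "P \<subseteq> set Cs" "derivation S \<psi> Ds" "C \<in> set Ds"
      unfolding derivable_def by (metis insertI1 insertI2)
    then show ?case by (intro exI [of _ "Cs @ Ds"]) (auto intro: derivation_append)
  qed
  then obtain Ds where Ds: "derivation S \<psi> Ds" "P \<subseteq> set Ds" by blast
  have "derivation S \<psi> (Ds @ [D])"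
    using Ds assms(1) unfolding derivation_def by (auto simp: nth_append less_Suc_eq)
  then show ?thesis unfolding derivable_def by (intro exI [of _ "Ds @ [D]"]) simp
qed

text \<open>Substitution into a clause with infinitely many variables is unsound, since every
  assignment making infinitely many of them true gives it even parity by convention.\<close>
definition holds :: "('v \<Rightarrow> bool) \<Rightarrow> 'v xor_clause \<Rightarrow> bool" where
  "holds \<tau> C \<longleftrightarrow> finite (fst C) \<and> sat_clause \<tau> C"

lemma derivable_sound:
  assumes sound: "\<And>P C. S P C \<Longrightarrow> \<forall>D\<in>P. holds \<tau> D \<Longrightarrow> holds \<tau> C"
    and \<psi>: "\<And>C. C \<in> \<psi> \<Longrightarrow> holds \<tau> C" and "derivable S \<psi> D"
  shows "holds \<tau> D"
proof -
  obtain Ds where Ds: "derivation S \<psi> Ds" "D \<in> set Ds"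
    using assms(3) unfolding derivable_def by blast
  have "holds \<tau> (Ds ! i)" if "i < length Ds" for i
    using that
  proof (induction i rule: less_induct)
    case (less i)
    consider "Ds ! i \<in> \<psi>" | P where "P \<subseteq> set (take i Ds)" "S P (Ds ! i)"
      using Ds(1) less.prems unfolding derivation_def by blast
    then show ?case
    proof cases
      case 1
      then show ?thesis by (rule \<psi>)
    next
      case 2
      have "holds \<tau> C" if "C \<in> P" for C
      proof -
        obtain j where "j < i" "C = Ds ! j"
          using 2(1) \<open>C \<in> P\<close> less.prems by (fastforce simp: in_set_conv_nth)
        then show ?thesis using less by simp
      qed
      then show ?thesis using sound [OF 2(2)] by blast
    qed
  qed
  then show ?thesis using Ds(2) by (auto simp: in_set_conv_nth)
qed

text \<open>An underived literal is false in some model of the premises, so it is not entailed;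
  soundness excludes the empty clause when the premises are satisfiable.\<close>

lemma deducible_if_saturated:
  assumes fin: "finite \<phi>" and nf: "three_xor_nf \<phi>" and part: "cycle_partitionable \<phi>"
    and sound: "\<And>\<tau> P C. S P C \<Longrightarrow> \<forall>D\<in>P. holds \<tau> D \<Longrightarrow> holds \<tau> C"
    and sat: "\<And>\<psi>. \<not> derivable S \<psi> falsum \<Longrightarrow> saturated {D. derivable S \<psi> D}"
  shows "deducible S \<phi>"
  unfolding deducible_def
proof (intro allI impI, elim conjE)
  fix ls l assume ls: "set ls \<subseteq> lits \<phi>" and l: "l \<in> lits \<phi>"
  let ?\<psi> = "\<phi> \<union> set ls"
  have model: "\<exists>\<tau>. satisfies \<tau> ?\<psi> \<and> \<tau> x = b"
    if "\<not> derivable S ?\<psi> falsum" "\<not> derivable S ?\<psi> ({x}, \<not> b)" for x b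
    using ls that
    by (intro saturated.model_exists [OF sat [OF that(1)] fin nf part])
      (auto simp: lits_def intro: derivable_premise)
  have finite: "finite (fst C)" if "C \<in> ?\<psi>" for C
  proof (cases "C \<in> \<phi>")
    case True
    then show ?thesis using nf card.infinite unfolding three_xor_nf_def by fastforce
  next
    case False
    then show ?thesis using ls that by (auto simp: lits_def)
  qed
  have consistent: "\<not> derivable S ?\<psi> falsum" if "satisfiable ?\<psi>"
  proof
    assume *: "derivable S ?\<psi> falsum"
    obtain \<tau> where "satisfies \<tau> ?\<psi>" using \<open>satisfiable ?\<psi>\<close> by (auto simp: satisfiable_def)
    have "holds \<tau> falsum"
    proof (rule derivable_sound [OF _ _ *])
      fix P C assume "S P C" "\<forall>D\<in>P. holds \<tau> D"
      then show "holds \<tau> C" by (rule sound)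
    next
      fix C assume "C \<in> ?\<psi>"
      with finite [OF this] \<open>satisfies \<tau> ?\<psi>\<close> show "holds \<tau> C"
        by (simp add: holds_def satisfies_def)
    qed
    then show False by (simp add: holds_def)
  qed
  show "(\<not> satisfiable ?\<psi> \<longrightarrow> derivable S ?\<psi> falsum) \<and>
      (satisfiable ?\<psi> \<longrightarrow> entails ?\<psi> l \<longrightarrow> derivable S ?\<psi> l)"
  proof (intro conjI impI)
    assume "\<not> satisfiable ?\<psi>"
    show "derivable S ?\<psi> falsum"
    proof (rule ccontr)
      assume *: "\<not> derivable S ?\<psi> falsum"
      \<comment> \<open>Any variable serves: at least one of its two unit clauses is underived, so
        \<open>model\<close> applies.\<close>
      obtain x :: 'a where "x = x" by simp
      have "\<not> (derivable S ?\<psi> ({x}, True) \<and> derivable S ?\<psi> ({x}, False))"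
        using saturated.unit_consistent [OF sat [OF *], of x] by simp
      then obtain b where "\<not> derivable S ?\<psi> ({x}, \<not> b)" by (metis (full_types))
      from model [OF * this] \<open>\<not> satisfiable ?\<psi>\<close> show False unfolding satisfiable_def by blast
    qed
  next
    assume "satisfiable ?\<psi>" "entails ?\<psi> l"
    obtain x b where xb: "l = ({x}, b)" using l by (auto simp: lits_def)
    show "derivable S ?\<psi> l"
    proof (rule ccontr)
      assume "\<not> derivable S ?\<psi> l"
      then obtain \<tau> where "satisfies \<tau> ?\<psi>" "\<tau> x = (\<not> b)"
        using model [of x "\<not> b"] consistent [OF \<open>satisfiable ?\<psi>\<close>] xb by auto
      moreover from this have "sat_clause \<tau> l"
        using \<open>entails ?\<psi> l\<close> unfolding entails_def by blast
      ultimately show False using xb by simp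
    qed
  qed
qed


section \<open>The two proof systems\<close>

lemma Subst_unit:
  "x \<in> V \<Longrightarrow> Subst {({x}, a), (V, p)} (V - {x}, p \<noteq> a)"
  using Subst.unit_pos [of x "(V, p)"] Subst.unit_neg [of x "(V, p)"] by (cases a) auto

lemma Subst_eqv:
  "x \<noteq> y \<Longrightarrow> x \<in> V \<Longrightarrow> Subst {({x, y}, a), (V, p)} (sym_diff (V - {x}) {y}, p \<noteq> a)"
  using Subst.eqv_pos [of x y "(V, p)"] Subst.eqv_neg [of x y "(V, p)"] by (cases a) auto

text \<open>Under \<tau> the atom and its replacement have the same value, so the parity of the
  clause is preserved.\<close>

lemma holds_subst_atom:
  assumes "holds \<tau> C" "finite W" "\<tau> x = (odd (card {y \<in> W. \<tau> y}) \<noteq> c)"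
  shows "holds \<tau> (subst_atom C x (W, c))"
proof (cases C)
  case (Pair V p)
  show ?thesis
  proof (cases "x \<in> V")
    case True
    have "finite V" using assms(1) Pair by (simp add: holds_def)
    then show ?thesis
      using assms Pair True odd_true_insert [of "V - {x}" x \<tau>]
        odd_true_sym_diff [of "V - {x}" W \<tau>]
      by (auto simp: holds_def sat_clause_def insert_absorb)
  next
    case False
    then show ?thesis using assms(1) Pair by simp
  qed
qed

lemma Subst_sound: "Subst P C \<Longrightarrow> \<forall>D\<in>P. holds \<tau> D \<Longrightarrow> holds \<tau> C"
proof (induction rule: Subst.induct)
  case (unit_pos x C)
  then show ?case by (intro holds_subst_atom) (simp_all add: holds_def)
next
  case (unit_neg x C)
  then show ?case by (intro holds_subst_atom) (simp_all add: holds_def)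
next
  case (eqv_pos x y C)
  then have "\<tau> x = (odd (card {z \<in> {y}. \<tau> z}) \<noteq> False)"
    unfolding odd_true_singleton by (auto simp: holds_def sat_clause_pair)
  with eqv_pos show ?case by (intro holds_subst_atom) simp_all
next
  case (eqv_neg x y C)
  then have "\<tau> x = (odd (card {z \<in> {y}. \<tau> z}) \<noteq> True)"
    unfolding odd_true_singleton by (auto simp: holds_def sat_clause_pair)
  with eqv_neg show ?case by (intro holds_subst_atom) simp_all
qed

lemma saturated_Subst:
  assumes "\<not> derivable Subst \<psi> falsum"
  shows "saturated {D. derivable Subst \<psi> D}"
proof -
  let ?S = "{D. derivable Subst \<psi> D}"
  have infer: "D \<in> ?S" if "Subst {C, C'} D" "C \<in> ?S" "C' \<in> ?S" for C C' D
    using derivable_inference [of Subst "{C, C'}" D \<psi>] that by auto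
  have unit: "(V - {x}, p \<noteq> a) \<in> ?S" if "({x}, a) \<in> ?S" "(V, p) \<in> ?S" "x \<in> V" for x a V p
    using infer [OF Subst_unit] that by simp
  have eqv: "(sym_diff (V - {x}) {y}, p \<noteq> a) \<in> ?S"
    if "x \<noteq> y" "({x, y}, a) \<in> ?S" "(V, p) \<in> ?S" "x \<in> V" for x y a V p
    using infer [OF Subst_eqv] that by simp
  have falsum: "falsum \<notin> ?S" using assms by simp
  \<comment> \<open>Substitution contracts a walk to one derived binary clause. If the ends
    coincide, an odd walk would instead yield the empty clause.\<close>
  have walk: "if v = w then \<not> p else ({v, w}, p) \<in> ?S" if "parity_walk ?S v w p" for v w p
    using that
  proof induction
    case (step v w p u q)
    show ?case
    proof (cases "v = w")
      case True
      with step show ?thesis by simp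
    next
      case False
      with step.IH have vw: "({w, v}, p) \<in> ?S" by (simp add: insert_commute)
      have *: "(sym_diff ({w, u} - {w}) {v}, q \<noteq> p) \<in> ?S"
        using eqv [OF _ vw step.hyps(3)] False by simp
      show ?thesis
      proof (cases "v = u")
        case True
        with * step.hyps(2) have "({}, q \<noteq> p) \<in> ?S" by (simp add: insert_Diff_if)
        with falsum True show ?thesis by (cases "q \<noteq> p") auto
      next
        case False
        have "sym_diff ({w, u} - {w}) {v} = {v, u}" using False step.hyps(2) by auto
        with * False show ?thesis by (simp add: eq_commute)
      qed
    qed
  qed simp
  show ?thesis
  proof
    fix x assume "({x}, True) \<in> ?S"
    then show "({x}, False) \<notin> ?S" using unit [of x True "{x}" False] falsum by auto
  next
    fix x y :: 'a and a b assume "x \<noteq> y" "({x}, a) \<in> ?S" "({x, y}, b) \<in> ?S"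
    then show "({y}, a \<noteq> b) \<in> ?S"
      using unit [of x a "{x, y}" b] by (simp add: insert_Diff_if eq_commute)
  next
    fix x y z :: 'a and a b assume "distinct [x, y, z]" "({x}, a) \<in> ?S" "({x, y, z}, b) \<in> ?S"
    then show "({y, z}, a \<noteq> b) \<in> ?S"
      using unit [of x a "{x, y, z}" b] by (simp add: insert_Diff_if eq_commute)
  next
    fix x y z :: 'a and p d
    assume *: "distinct [x, y, z]" "parity_walk ?S x y p" "({x, y, z}, d) \<in> ?S"
    have "sym_diff ({x, y, z} - {x}) {y} = {z}" using *(1) by auto
    with eqv [of x y p "{x, y, z}" d] walk [OF *(2)] * show "({z}, p \<noteq> d) \<in> ?S"
      by (simp add: eq_commute)
  next
    fix x p assume "parity_walk ?S x x p"
    from walk [OF this] show "\<not> p" by simp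
  qed
qed

section \<open>Soundness and saturation of EC\<close>

lemma xor_list_simps [simp]: "xor_list [] \<longleftrightarrow> False" "xor_list (c # cs) \<longleftrightarrow> c \<noteq> xor_list cs"
  by (simp_all add: xor_list_def)

lemma xor_list_append: "xor_list (as @ bs) = (xor_list as \<noteq> xor_list bs)"
  by (induction as) auto

text \<open>Each interior value occurs in two consecutive labels and cancels.\<close>

lemma xor_list_telescope:
  fixes \<tau> :: "'a \<Rightarrow> bool"
  assumes "length xs = Suc (length cs)"
    "\<And>i. i < length cs \<Longrightarrow> cs ! i = (\<tau> (xs ! i) \<noteq> \<tau> (xs ! Suc i))"
  shows "xor_list cs = (\<tau> (hd xs) \<noteq> \<tau> (last xs))"
  using assms
proof (induction cs arbitrary: xs)
  case Nil
  then show ?case by (cases xs) auto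
next
  case (Cons c cs)
  then obtain x y ys where xs: "xs = x # y # ys" by (metis Suc_length_conv length_Cons)
  have "xor_list cs = (\<tau> y \<noteq> \<tau> (last (y # ys)))"
    using Cons.IH [of "y # ys"] Cons.prems(1) Cons.prems(2) [of "Suc _"] xs by simp
  moreover have "c = (\<tau> x \<noteq> \<tau> y)" using Cons.prems(2) [of 0] xs by simp
  ultimately show ?case using xs by auto
qed

lemma EC_finite: "EC P D \<Longrightarrow> finite P"
proof (induction rule: EC.induct)
  case (imply xs y cs d)
  have "finite {i. Suc i < length xs}" by (rule finite_subset [of _ "{..<length xs}"]) auto
  then show ?case by simp
qed auto

lemma EC_sound: "EC P C \<Longrightarrow> \<forall>D\<in>P. holds \<tau> D \<Longrightarrow> holds \<tau> C"
proof (induction rule: EC.induct)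
  case (conflict x)
  then show ?case by (simp add: holds_def)
next
  case (unit2 x y a b)
  then show ?case using sat_clause_pair [of x y \<tau> b] by (auto simp: holds_def)
next
  case (unit3 x y z a b)
  then show ?case
    using sat_clause_triple [of x y z \<tau> b] sat_clause_pair [of y z \<tau> "a \<noteq> b"]
    by (auto simp: holds_def)
next
  case (imply xs y cs d)
  have "cs ! i = (\<tau> (xs ! i) \<noteq> \<tau> (xs ! Suc i))" if "i < length cs" for i
  proof -
    have "Suc i < length xs" using that imply(5) by simp
    then have "sat_clause \<tau> ({xs ! i, xs ! Suc i}, cs ! i)"
      using imply.prems unfolding holds_def by blast
    moreover have "xs ! i \<noteq> xs ! Suc i"
      using \<open>distinct xs\<close> \<open>Suc i < length xs\<close> by (simp add: nth_eq_iff_index_eq)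
    ultimately show ?thesis by (auto simp: sat_clause_pair)
  qed
  then have "xor_list cs = (\<tau> (hd xs) \<noteq> \<tau> (last xs))"
    using imply(1,5) by (intro xor_list_telescope) auto
  moreover have "hd xs \<noteq> last xs"
    using imply(1,2) by (cases xs) auto
  then have "(\<tau> (hd xs) \<noteq> (\<tau> (last xs) \<noteq> \<tau> y)) = d"
    using imply sat_clause_triple [of "hd xs" "last xs" y \<tau> d] by (simp add: holds_def)
  ultimately show ?case by (auto simp: holds_def)
next
  case (eqv_conflict xs cs)
  have "hd xs = xs ! 0" using eqv_conflict(1) by (intro hd_conv_nth) auto
  \<comment> \<open>The cycle is unrolled by repeating its first variable at the end, so telescoping
    compares that variable with itself.\<close>
  have "cs ! i = (\<tau> ((xs @ [hd xs]) ! i) \<noteq> \<tau> ((xs @ [hd xs]) ! Suc i))" if "i < length cs" for i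
  proof -
    let ?j = "Suc i mod length xs"
    have i: "i < length xs" using that eqv_conflict(3) by simp
    then have "sat_clause \<tau> ({xs ! i, xs ! ?j}, cs ! i)"
      using eqv_conflict.prems unfolding holds_def by blast
    moreover have j: "?j < length xs" "?j = (if Suc i = length xs then 0 else Suc i)"
      using i mod_less_divisor [of "length xs" "Suc i"] by (linarith, auto)
    moreover have "xs ! i \<noteq> xs ! ?j"
      using eqv_conflict(1,2) i j by (simp add: nth_eq_iff_index_eq)
    moreover have "(xs @ [hd xs]) ! Suc i = xs ! ?j"
      using i j(2) \<open>hd xs = xs ! 0\<close> by (auto simp: nth_append)
    ultimately show ?thesis using i by (auto simp: sat_clause_pair nth_append)
  qed
  then have "xor_list cs = (\<tau> (hd (xs @ [hd xs])) \<noteq> \<tau> (last (xs @ [hd xs])))"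
    using eqv_conflict(3) by (intro xor_list_telescope) auto
  then have "\<not> xor_list cs" using eqv_conflict(1) by (cases xs) auto
  then show ?case using eqv_conflict(4) by simp
qed

text \<open>The chain rules of EC require distinct variables, whereas walks may repeat them, so each
  walk is first traded for a simple path of the same parity.\<close>

lemma saturated_EC:
  assumes "\<not> derivable EC \<psi> falsum"
  shows "saturated {D. derivable EC \<psi> D}"
proof -
  let ?S = "{D. derivable EC \<psi> D}"
  have infer: "D \<in> ?S" if "EC P D" "P \<subseteq> ?S" for P D
    using derivable_inference [of EC P D \<psi>] EC_finite [OF that(1)] that by auto
  have falsum: "falsum \<notin> ?S" using assms by simp
  \<comment> \<open>Whenever a walk returns to an earlier vertex, the cycle it closes is even by the last rule
    of EC and can be cut out.\<close>
  have path: "\<exists>xs cs. distinct xs \<and> length xs = Suc (length cs) \<and> hd xs = v \<and> last xs = w \<and>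
      (\<forall>i<length cs. ({xs ! i, xs ! Suc i}, cs ! i) \<in> ?S) \<and> xor_list cs = p"
    if "parity_walk ?S v w p" for v w p
    using that
  proof induction
    case (refl v)
    show ?case by (intro exI [of _ "[v]"] exI [of _ "[]"]) simp
  next
    case (step v w p u q)
    then obtain xs cs where xs: "distinct xs" "length xs = Suc (length cs)" "hd xs = v"
      "last xs = w" "\<And>i. i < length cs \<Longrightarrow> ({xs ! i, xs ! Suc i}, cs ! i) \<in> ?S"
      "xor_list cs = p" by blast
    then have w: "xs ! length cs = w" by (metis diff_Suc_1 last_conv_nth length_0_conv nat.distinct(1))
    show ?case
    proof (cases "u \<in> set xs")
      case False
      have "({(xs @ [u]) ! i, (xs @ [u]) ! Suc i}, (cs @ [q]) ! i) \<in> ?S"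
        if "i < length (cs @ [q])" for i
        using that xs(2,5) w step.hyps(3) by (cases "i = length cs") (auto simp: nth_append)
      then show ?thesis
        using False xs
        by (intro exI [of _ "xs @ [u]"] exI [of _ "cs @ [q]"])
          (auto simp: xor_list_append hd_append)
    next
      case True
      then obtain k where k: "k < length xs" "xs ! k = u" by (auto simp: in_set_conv_nth)
      have "k \<noteq> length cs" using k w step.hyps(2) by auto
      with k xs(2) have k_less: "k < length cs" by simp
      \<comment> \<open>The part of the path from \<open>u\<close> to \<open>w\<close>, closed by
        the new edge labelled \<open>q\<close>; it has at least two vertices because
        \<open>w\<close> differs from \<open>u\<close>.\<close>
      let ?ys = "drop k xs" and ?ds = "drop k cs @ [q]"
      have "({?ys ! i, ?ys ! (Suc i mod length ?ys)}, ?ds ! i) \<in> ?S" if "i < length ?ys" for i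
      proof (cases "i = length cs - k")
        case True
        then show ?thesis using k k_less w xs(2) step.hyps(3) by (simp add: nth_append Suc_diff_le)
      next
        case False
        with that xs(2) k_less have i: "k + i < length cs" by simp
        then have "Suc i mod length ?ys = Suc i" using xs(2) by simp
        moreover have "?ds ! i = cs ! (k + i)" using i by (simp add: nth_append less_diff_conv add.commute)
        ultimately show ?thesis using xs(5) [OF i] i xs(2) by simp
      qed
      then have "\<not> xor_list ?ds"
        using infer [OF EC.eqv_conflict [of ?ys ?ds]] falsum xs(1,2) k_less by fastforce
      then have "xor_list (take k cs) = (p \<noteq> q)"
        using xs(6) xor_list_append [of "take k cs" "drop k cs"]
        by (auto simp: xor_list_append)
      moreover have "last (take (Suc k) xs) = u"
        using k by (simp add: take_Suc_conv_app_nth)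
      ultimately show ?thesis
        using xs k k_less
        by (intro exI [of _ "take (Suc k) xs"] exI [of _ "take k cs"]) auto
    qed
  qed
  show ?thesis
  proof
    fix x assume "({x}, True) \<in> ?S"
    then show "({x}, False) \<notin> ?S" using infer [OF EC.conflict, of x] falsum by auto
  next
    fix x y :: 'a and a b assume "x \<noteq> y" "({x}, a) \<in> ?S" "({x, y}, b) \<in> ?S"
    then show "({y}, a \<noteq> b) \<in> ?S" using infer [OF EC.unit2 [of x y a b]] by simp
  next
    fix x y z :: 'a and a b assume "distinct [x, y, z]" "({x}, a) \<in> ?S" "({x, y, z}, b) \<in> ?S"
    then show "({y, z}, a \<noteq> b) \<in> ?S" using infer [OF EC.unit3 [of x y z a b]] by simp
  next
    fix x y z :: 'a and p d
    assume *: "distinct [x, y, z]" "parity_walk ?S x y p" "({x, y, z}, d) \<in> ?S"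
    obtain xs cs where xs: "distinct xs" "length xs = Suc (length cs)" "hd xs = x" "last xs = y"
      "\<And>i. i < length cs \<Longrightarrow> ({xs ! i, xs ! Suc i}, cs ! i) \<in> ?S" "xor_list cs = p"
      using path [OF *(2)] by blast
    have "cs \<noteq> []" using xs(2-4) *(1) by (cases xs) auto
    then have "length xs \<ge> 2" using xs(2) by (cases cs) auto
    then have "EC ({({xs ! i, xs ! Suc i}, cs ! i) | i. Suc i < length xs} \<union> {({hd xs, last xs, z}, d)})
        ({z}, xor_list cs \<noteq> d)"
      by (rule EC.imply) (use xs(1-4) *(1) in auto)
    then have "({z}, xor_list cs \<noteq> d) \<in> ?S"
    proof (rule infer)
      show "{({xs ! i, xs ! Suc i}, cs ! i) | i. Suc i < length xs} \<union> {({hd xs, last xs, z}, d)} \<subseteq> ?S"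
        using xs(2,5) *(3) unfolding xs(3,4) by auto
    qed
    then show "({z}, p \<noteq> d) \<in> ?S" unfolding xs(6) .
  next
    fix x p assume "parity_walk ?S x x p"
    then obtain xs cs where xs: "distinct xs" "length xs = Suc (length cs)" "hd xs = x"
      "last xs = x" "xor_list cs = p"
      using path by blast
    then have "cs = []" by (cases xs) (auto split: if_splits)
    then show "\<not> p" using xs(5) by simp
  qed
qed

text \<open>Both systems are instances of the same reduction, so neither has to simulate the other.
  A conjunction is taken to be finite.\<close>

theorem theorem2:
  fixes \<phi> :: "'v xor_clause set"
  assumes "finite \<phi>"
    and "three_xor_nf \<phi>"
    and "cycle_partitionable \<phi>"
  shows "deducible Subst \<phi> \<and> deducible EC \<phi>"
proof
  show "deducible Subst \<phi>"
    by (rule deducible_if_saturated [OF assms]) (blast intro: Subst_sound saturated_Subst)+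
  show "deducible EC \<phi>"
    by (rule deducible_if_saturated [OF assms]) (blast intro: EC_sound saturated_EC)+
qed

end
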